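(* Let $d\ge1$. Every Hahn-classical $d$-orthogonal polynomial sequence is very classical; that is, if $\{P_n\}_{n\ge0}$ is a $d$-OPS such that $\{P_n^{[1]}\}_{n\ge0}$ is a $d$-OPS, then $\{P_n^{[m]}\}_{n\ge0}$ is a $d$-OPS for every integer $m\ge1$.
   Context: All polynomial sequences are monic with complex coefficients, $\deg P_n=n$. A monic sequence $\{P_n\}_{n\ge0}$ is a $d$-orthogonal polynomial sequence ($d$-OPS) if there is a vector of linear forms $(u_0,\dots,u_{d-1})^T$ on complex polynomials such that, for each $0\le t\le d-1$ and all $m\ge0$: $\langle u_t,x^mP_n\rangle=0$ for $n\ge md+t+1$ and $\langle u_t,x^mP_{md+t}\rangle\ne0$. The normalized derivative sequences are defined by $P_n^{[0]}=P_n$ and $P_n^{[m+1]}=(P_{n+1}^{[m]})'/(n+1)$. A $d$-OPS is Hahn-classical if $\{P_n^{[1]}\}$ is also a $d$-OPS; it is very classical if its normalized derivative sequences of every order are $d$-OPS. *)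

theory Defs
  imports Complex_Main "HOL-Computational_Algebra.Polynomial"
begin

definition monic_poly_seq :: "(nat \<Rightarrow> complex poly) \<Rightarrow> bool" where
  "monic_poly_seq P \<longleftrightarrow> (\<forall>n. degree (P n) = n \<and> lead_coeff (P n) = 1)"

abbreviation linear_form :: "(complex poly \<Rightarrow> complex) \<Rightarrow> bool" where
  "linear_form \<equiv> Vector_Spaces.linear smult (*)"

text \<open>The vector of forms is \<open>u 0, \<dots>, u (d - 1)\<close>; the values of \<open>u\<close> at indices \<open>\<ge> d\<close> are irrelevant.\<close>

definition d_orthogonal_wrt ::
    "nat \<Rightarrow> (nat \<Rightarrow> complex poly \<Rightarrow> complex) \<Rightarrow> (nat \<Rightarrow> complex poly) \<Rightarrow> bool" where
  "d_orthogonal_wrt d u P \<longleftrightarrow>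
     (\<forall>t<d. \<forall>m. (\<forall>n\<ge>m * d + t + 1. u t (monom 1 m * P n) = 0) \<and>
               u t (monom 1 m * P (m * d + t)) \<noteq> 0)"

definition d_OPS :: "nat \<Rightarrow> (nat \<Rightarrow> complex poly) \<Rightarrow> bool" where
  "d_OPS d P \<longleftrightarrow>
     monic_poly_seq P \<and> (\<exists>u. (\<forall>t<d. linear_form (u t)) \<and> d_orthogonal_wrt d u P)"

primrec normalized_deriv_seq :: "nat \<Rightarrow> (nat \<Rightarrow> complex poly) \<Rightarrow> nat \<Rightarrow> complex poly" where
  "normalized_deriv_seq 0 P = P"
| "normalized_deriv_seq (Suc m) P =
     (\<lambda>n. smult (1 / of_nat (n + 1)) (pderiv (normalized_deriv_seq m P (n + 1))))"

definition hahn_classical :: "nat \<Rightarrow> (nat \<Rightarrow> complex poly) \<Rightarrow> bool" where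
  "hahn_classical d P \<longleftrightarrow> d_OPS d P \<and> d_OPS d (normalized_deriv_seq 1 P)"

definition very_classical :: "nat \<Rightarrow> (nat \<Rightarrow> complex poly) \<Rightarrow> bool" where
  "very_classical d P \<longleftrightarrow> d_OPS d P \<and> (\<forall>m\<ge>1. d_OPS d (normalized_deriv_seq m P))"

end

theory Submission
  imports Defs
begin

text \<open>
  A monic sequence is \<open>d\<close>-orthogonal iff its multiplication-by-\<open>x\<close> matrix has lower bandwidth
  exactly \<open>d\<close>, with no zero on the outermost diagonal. Differentiating \<open>x P\<^sub>n\<close> shows that the
  expansion of \<open>P\<^sub>n\<close> in the normalized derivatives has bandwidth \<open>d + 1\<close>; both band conditions
  then propagate to all orders, so only the outermost diagonals can fail. Divided by binomials,
  these are \<open>A j - m G (j - 1)\<close> at order \<open>m\<close> (up to a shift of \<open>j\<close>), where \<open>G\<close> comes from the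
  outermost diagonal of the expansion of \<open>P\<^sub>n\<close>. Comparing extreme coefficients of \<open>x P\<^sub>n\<close> yields
  \<open>A (j + d + 1) G j = G (j + d) (A (j + 1) - G j)\<close>: the ratio \<open>A (j + 1) / G j\<close> drops by 1 when
  \<open>j\<close> grows by \<open>d\<close>. If it equalled some \<open>m > 1\<close>, it would reach 1 later, contradicting the
  \<open>d\<close>-orthogonality of the first derivatives.
\<close>

section \<open>Coordinates with respect to a monic polynomial basis\<close>

text \<open>These are the values at \<open>x^n\<close> of the \<open>j\<close>-th functional of the
  basis dual to \<open>S\<close>. Since \<open>S n\<close> is monic of degree \<open>n\<close>,
  requiring the functional to send it to 1 or 0 determines the value at its top monomial from the
  lower ones.\<close>

fun dual_moment :: "(nat \<Rightarrow> complex poly) \<Rightarrow> nat \<Rightarrow> nat \<Rightarrow> complex" where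
  "dual_moment S j n = (if n = j then 1 else 0) - (\<Sum>i<n. coeff (S n) i * dual_moment S j i)"

declare dual_moment.simps [simp del]

definition coord :: "(nat \<Rightarrow> complex poly) \<Rightarrow> nat \<Rightarrow> complex poly \<Rightarrow> complex" where
  "coord S j p = (\<Sum>i\<le>degree p. coeff p i * dual_moment S j i)"

lemma coord_eq:
  assumes "degree p \<le> N"
  shows "coord S j p = (\<Sum>i\<le>N. coeff p i * dual_moment S j i)"
  unfolding coord_def
  by (rule sum.mono_neutral_left) (use assms in \<open>auto simp: coeff_eq_0\<close>)

lemma coord_add: "coord S j (p + q) = coord S j p + coord S j q"
proof -
  have "degree (p + q) \<le> max (degree p) (degree q)"
    by (rule degree_add_le_max)
  then show ?thesis
    by (simp add: coord_eq[where N = "max (degree p) (degree q)"] algebra_simps sum.distrib)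
qed

lemma coord_smult: "coord S j (smult c p) = c * coord S j p"
  by (simp add: coord_eq[where N = "degree p"] degree_smult_le sum_distrib_left mult.assoc)

lemma coord_0: "coord S j 0 = 0"
  by (simp add: coord_def)

lemma coord_diff: "coord S j (p - q) = coord S j p - coord S j q"
  using coord_add[of S j "p - q" q] by simp

lemma coord_sum: "coord S j (\<Sum>i\<in>I. f i) = (\<Sum>i\<in>I. coord S j (f i))"
  by (induction I rule: infinite_finite_induct) (auto simp: coord_0 coord_add)

lemma linear_form_coord: "linear_form (coord S j)"
  by unfold_locales (auto simp: coord_add coord_smult algebra_simps smult_add_right smult_add_left)

lemma coord_basis:
  assumes "monic_poly_seq S"
  shows "coord S j (S n) = (if n = j then 1 else 0)"
proof -
  have "degree (S n) = n" "coeff (S n) n = 1"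
    using assms unfolding monic_poly_seq_def by metis+
  then have "coord S j (S n) = (\<Sum>i<n. coeff (S n) i * dual_moment S j i) + dual_moment S j n"
    by (simp add: coord_def flip: lessThan_Suc_atMost)
  then show ?thesis
    by (simp add: dual_moment.simps[of S j n])
qed

lemma monic_seq_spans:
  assumes "monic_poly_seq S" "degree p \<le> N"
  shows "\<exists>f. p = (\<Sum>i\<le>N. smult (f i) (S i))"
  using assms(2)
proof (induction N arbitrary: p)
  case 0
  have "degree (S 0) = 0" "coeff (S 0) 0 = 1"
    using assms(1) unfolding monic_poly_seq_def by metis+
  then have "S 0 = 1"
    by (metis degree_0_id one_pCons)
  moreover have "p = [:coeff p 0:]"
    using 0 degree_0_id by (metis le_zero_eq)
  ultimately show ?case
    by (intro exI[of _ "\<lambda>_. coeff p 0"]) simp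
next
  case (Suc N)
  have S: "degree (S (Suc N)) = Suc N" "coeff (S (Suc N)) (Suc N) = 1"
    using assms(1) unfolding monic_poly_seq_def by metis+
  define c where "c = coeff p (Suc N)"
  have "degree (p - smult c (S (Suc N))) \<le> N"
  proof (rule degree_le, intro allI impI)
    fix i assume "N < i"
    show "coeff (p - smult c (S (Suc N))) i = 0"
    proof (cases "i = Suc N")
      case True
      then show ?thesis using S by (simp add: c_def)
    next
      case False
      with \<open>N < i\<close> S Suc.prems show ?thesis by (simp add: coeff_eq_0)
    qed
  qed
  from Suc.IH[OF this] obtain f where
    f: "p - smult c (S (Suc N)) = (\<Sum>i\<le>N. smult (f i) (S i))" by blast
  have "p = (\<Sum>i\<le>Suc N. smult ((f(Suc N := c)) i) (S i))"
    using f by (simp add: diff_eq_eq)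
  then show ?case by blast
qed

lemma coord_expansion:
  assumes "monic_poly_seq S" "degree p \<le> N"
  shows "p = (\<Sum>i\<le>N. smult (coord S i p) (S i))"
proof -
  obtain f where f: "p = (\<Sum>i\<le>N. smult (f i) (S i))"
    using monic_seq_spans[OF assms] by blast
  have "coord S i p = f i" if "i \<le> N" for i
    by (subst f) (use that in \<open>simp add: coord_sum coord_smult coord_basis[OF assms(1)] if_distrib
        cong: if_cong\<close>)
  then show ?thesis using f by simp
qed

section \<open>Multiplication by \<open>x\<close> and the band criterion for d-orthogonality\<close>

abbreviation times_x :: "complex poly \<Rightarrow> complex poly" where
  "times_x p \<equiv> monom 1 1 * p"

lemma degree_times_x: "degree (times_x p) \<le> degree p + 1"
  by (rule order_trans[OF degree_mult_le]) (simp add: degree_monom_eq)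

lemma degree_monic_seq: "monic_poly_seq S \<Longrightarrow> degree (S n) = n"
  by (simp add: monic_poly_seq_def)

lemma monom_Suc_mult_expansion:
  assumes "monic_poly_seq S"
  shows "monom 1 (Suc m) * S n =
    (\<Sum>i\<le>n + 1. smult (coord S i (times_x (S n))) (monom 1 m * S i))"
proof -
  have "monom 1 (Suc m) * S n = monom 1 m * times_x (S n)"
    by (simp add: mult_monom flip: mult.assoc)
  also have "\<dots> = monom 1 m * (\<Sum>i\<le>n + 1. smult (coord S i (times_x (S n))) (S i))"
    using coord_expansion[OF assms, of "times_x (S n)" "n + 1"] degree_times_x[of "S n"]
    by (simp add: degree_monic_seq[OF assms])
  finally show ?thesis
    by (simp only: sum_distrib_left mult_smult_right)
qed

lemma linear_form_add: "linear_form u \<Longrightarrow> u (p + q) = u p + u q"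
  by (simp add: Vector_Spaces.linear_iff)

lemma linear_form_smult: "linear_form u \<Longrightarrow> u (smult c p) = c * u p"
  by (simp add: Vector_Spaces.linear_iff)

lemma linear_form_sum: "linear_form u \<Longrightarrow> u (\<Sum>i\<in>I. f i) = (\<Sum>i\<in>I. u (f i))"
  using linear_form_smult[of u 0 0]
  by (induction I rule: infinite_finite_induct) (auto simp: linear_form_add)

text \<open>A recurrence expanding \<open>x S_n\<close> down to \<open>S_(n-d)\<close> with nonzero
  last coefficient. The other side of the band is automatic by degree.\<close>

definition exact_band :: "nat \<Rightarrow> (nat \<Rightarrow> complex poly) \<Rightarrow> bool" where
  "exact_band d S \<longleftrightarrow> (\<forall>n j. j + d < n \<longrightarrow> coord S j (times_x (S n)) = 0) \<and>
     (\<forall>j. coord S j (times_x (S (j + d))) \<noteq> 0)"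

text \<open>With \<open>j = m * d + t\<close>, the functional sending \<open>p\<close> to
  \<open>u t (x^m p)\<close> kills every \<open>S i\<close> with \<open>i > j\<close> but not
  \<open>S j\<close>. This triangularity isolates the coordinates of \<open>x S_n\<close> one at a
  time, from the lowest up.\<close>

lemma d_OPS_imp_exact_band:
  assumes "d \<ge> 1" "d_OPS d S"
  shows "exact_band d S"
proof -
  from assms(2) obtain u where S: "monic_poly_seq S" and lin: "\<And>t. t < d \<Longrightarrow> linear_form (u t)"
    and orth: "d_orthogonal_wrt d u S"
    unfolding d_OPS_def by blast
  have key: "u (j mod d) (monom 1 (Suc (j div d)) * S n) =
      coord S j (times_x (S n)) * u (j mod d) (monom 1 (j div d) * S j)"
    if below: "\<And>i. i < j \<Longrightarrow> coord S i (times_x (S n)) = 0" and "j \<le> n" for j n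
  proof -
    define t m where "t = j mod d" and "m = j div d"
    have j: "j = m * d + t" by (simp add: t_def m_def)
    have t: "t < d" using assms(1) by (simp add: t_def)
    have 0: "u t (monom 1 m * S i) = 0" if "i > j" for i
      using orth t that unfolding d_orthogonal_wrt_def j by auto
    have "u t (monom 1 (Suc m) * S n) =
        (\<Sum>i\<le>n + 1. coord S i (times_x (S n)) * u t (monom 1 m * S i))"
      by (simp only: monom_Suc_mult_expansion[OF S] linear_form_sum[OF lin[OF t]]
          linear_form_smult[OF lin[OF t]])
    also have "\<dots> = (\<Sum>i\<in>{j}. coord S i (times_x (S n)) * u t (monom 1 m * S i))"
    proof (rule sum.mono_neutral_right; (intro ballI)?)
      fix i assume "i \<in> {..n + 1} - {j}"
      then have "i < j \<or> i > j" by auto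
      then show "coord S i (times_x (S n)) * u t (monom 1 m * S i) = 0"
        using 0 below by auto
    qed (use that in auto)
    finally show ?thesis by (simp add: t_def m_def)
  qed
  have nz: "u (j mod d) (monom 1 (j div d) * S j) \<noteq> 0" for j
  proof -
    have "j mod d < d" using assms(1) by simp
    with orth have "u (j mod d) (monom 1 (j div d) * S (j div d * d + j mod d)) \<noteq> 0"
      unfolding d_orthogonal_wrt_def by blast
    then show ?thesis by simp
  qed
  have zero: "coord S j (times_x (S n)) = 0" if "j + d < n" for j n
    using that
  proof (induction j rule: less_induct)
    case (less j)
    have "j = j div d * d + j mod d" by simp
    then have "n \<ge> Suc (j div d) * d + j mod d + 1" using less.prems by simp
    moreover have "j mod d < d" using assms(1) by simp
    ultimately have "u (j mod d) (monom 1 (Suc (j div d)) * S n) = 0"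
      using orth unfolding d_orthogonal_wrt_def by blast
    with key[of j n] less nz[of j] show ?case by simp
  qed
  have "coord S j (times_x (S (j + d))) \<noteq> 0" for j
  proof -
    have "j mod d < d" using assms(1) by simp
    with orth have "u (j mod d) (monom 1 (Suc (j div d)) * S (Suc (j div d) * d + j mod d)) \<noteq> 0"
      unfolding d_orthogonal_wrt_def by blast
    moreover have "Suc (j div d) * d + j mod d = j + d" by simp
    ultimately show ?thesis using key[of j "j + d"] zero by auto
  qed
  with zero show ?thesis unfolding exact_band_def by blast
qed

text \<open>The dual functionals \<open>coord S t\<close> with \<open>t < d\<close> serve as forms.
  Each factor \<open>x\<close> lowers indices by at most \<open>d\<close>, so \<open>x^m S_n\<close>
  reaches \<open>S t\<close> only for \<open>n \<le> m * d + t\<close>, and at equality only along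
  the outermost diagonal.\<close>

lemma exact_band_imp_d_OPS:
  assumes S: "monic_poly_seq S" and band: "exact_band d S"
  shows "d_OPS d S"
proof -
  have step: "coord S t (monom 1 (Suc m) * S n) =
      (\<Sum>i\<le>n + 1. coord S i (times_x (S n)) * coord S t (monom 1 m * S i))" for t m n
    by (simp only: monom_Suc_mult_expansion[OF S] coord_sum coord_smult)
  have "(\<forall>n\<ge>m * d + t + 1. coord S t (monom 1 m * S n) = 0) \<and>
      coord S t (monom 1 m * S (m * d + t)) \<noteq> 0" for t m
  proof (induction m)
    case 0
    show ?case by (simp add: coord_basis[OF S])
  next
    case (Suc m)
    \<comment> \<open>Indices \<open>i < n - d\<close> fall outside the band. The others are at
      least \<open>m * d + t\<close>, where only equality escapes the induction hypothesis.\<close>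
    have term0: "coord S i (times_x (S n)) * coord S t (monom 1 m * S i) = 0"
      if "n \<ge> Suc m * d + t" "i \<noteq> m * d + t \<or> n > Suc m * d + t" for n i
    proof (cases "i + d < n")
      case True
      then show ?thesis using band by (simp add: exact_band_def)
    next
      case False
      then have "i \<ge> m * d + t + 1" using that by auto
      then show ?thesis using Suc.IH by simp
    qed
    let ?n = "m * d + t + d"
    have "coord S t (monom 1 (Suc m) * S ?n) =
        (\<Sum>i\<in>{m * d + t}. coord S i (times_x (S ?n)) * coord S t (monom 1 m * S i))"
      unfolding step
    proof (rule sum.mono_neutral_right; (intro ballI)?)
      fix i assume "i \<in> {..?n + 1} - {m * d + t}"
      then show "coord S i (times_x (S ?n)) * coord S t (monom 1 m * S i) = 0"
        by (intro term0) auto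
    qed auto
    also have "\<dots> \<noteq> 0"
      using band Suc.IH by (simp add: exact_band_def)
    finally have "coord S t (monom 1 (Suc m) * S (Suc m * d + t)) \<noteq> 0"
      by (simp add: algebra_simps)
    moreover have "coord S t (monom 1 (Suc m) * S n) = 0" if "n \<ge> Suc m * d + t + 1" for n
      unfolding step using that by (intro sum.neutral ballI term0) auto
    ultimately show ?case by blast
  qed
  then show ?thesis
    unfolding d_OPS_def d_orthogonal_wrt_def using S linear_form_coord by blast
qed

section \<open>Coordinates of the normalized derivatives\<close>

lemma monic_normalized_deriv_seq:
  assumes "monic_poly_seq P"
  shows "monic_poly_seq (normalized_deriv_seq m P)"
proof (induction m)
  case (Suc m)
  let ?S = "normalized_deriv_seq m P"
  have S: "degree (?S (n + 1)) = n + 1" "coeff (?S (n + 1)) (n + 1) = 1" for n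
    using Suc unfolding monic_poly_seq_def by metis+
  have nz: "(of_nat (n + 1) :: complex) \<noteq> 0" for n by (metis Suc_eq_plus1 of_nat_neq_0)
  have "degree (normalized_deriv_seq (Suc m) P n) = n" for n
    using S(1)[of n] nz[of n] by (simp add: degree_pderiv)
  moreover have "coeff (normalized_deriv_seq (Suc m) P n) n = 1" for n
    using S(2)[of n] nz[of n] by (simp add: coeff_pderiv del: of_nat_Suc)
  ultimately show ?case by (simp add: monic_poly_seq_def)
qed (use assms in simp)

lemma coord_pderiv:
  assumes "monic_poly_seq P"
  shows "coord (normalized_deriv_seq (Suc m) P) j (pderiv p) =
    of_nat (j + 1) * coord (normalized_deriv_seq m P) (j + 1) p"
proof -
  let ?S = "normalized_deriv_seq m P" and ?T = "normalized_deriv_seq (Suc m) P"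
  note S = monic_normalized_deriv_seq[OF assms, of m]
  note T = monic_normalized_deriv_seq[OF assms, of "Suc m"]
  \<comment> \<open>The bound \<open>j + 1\<close> keeps index \<open>j\<close> inside the sum even
    when \<open>p\<close> has small degree.\<close>
  define N where "N = max (degree p) (j + 1)"
  have nz: "(of_nat (n + 1) :: complex) \<noteq> 0" for n by (metis Suc_eq_plus1 of_nat_neq_0)
  have D: "pderiv (?S (Suc i)) = smult (of_nat (i + 1)) (?T i)" for i
    using nz[of i] by (simp del: of_nat_Suc)
  have "degree (?S 0) = 0" using S by (simp add: monic_poly_seq_def)
  then have D0: "pderiv (?S 0) = 0" by (simp add: pderiv_eq_0_iff)
  have "p = (\<Sum>i\<le>Suc N. smult (coord ?S i p) (?S i))"
    by (rule coord_expansion[OF S]) (simp add: N_def)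
  then have "pderiv p = pderiv (\<Sum>i\<le>Suc N. smult (coord ?S i p) (?S i))"
    by simp
  also have "\<dots> = (\<Sum>i\<le>Suc N. smult (coord ?S i p) (pderiv (?S i)))"
    by (simp only: higher_pderiv_sum[where n = 1, simplified] pderiv_smult)
  also have "\<dots> = (\<Sum>i\<le>N. smult (coord ?S (Suc i) p * of_nat (i + 1)) (?T i))"
    by (subst sum.atMost_Suc_shift) (simp only: D D0 smult_smult, simp)
  finally have "coord ?T j (pderiv p) =
      (\<Sum>i\<le>N. coord ?S (Suc i) p * of_nat (i + 1) * (if i = j then 1 else 0))"
    by (simp only: coord_sum coord_smult coord_basis[OF T])
  also have "\<dots> = coord ?S (Suc j) p * of_nat (j + 1)"
    by (simp add: N_def if_distrib cong: if_cong)
  finally show ?thesis by (simp add: mult.commute)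
qed

lemma times_x_normalized_deriv:
  "smult (of_nat (n + 1)) (times_x (normalized_deriv_seq (Suc m) P n)) =
     pderiv (times_x (normalized_deriv_seq m P (n + 1))) - normalized_deriv_seq m P (n + 1)"
proof -
  have "(of_nat (n + 1) :: complex) \<noteq> 0" by (metis Suc_eq_plus1 of_nat_neq_0)
  then show ?thesis by (simp add: pderiv_mult pderiv_monom monom_0)
qed

text \<open>Coordinate form of \<open>x p' = (x p)' - p\<close> for \<open>p\<close> the member of
  index \<open>n + 1\<close> at order \<open>m\<close>.\<close>

lemma coord_times_x_deriv:
  assumes "monic_poly_seq P"
  shows "of_nat (n + 1) *
      coord (normalized_deriv_seq (Suc m) P) j (times_x (normalized_deriv_seq (Suc m) P n)) =
    of_nat (j + 1) *
      coord (normalized_deriv_seq m P) (j + 1) (times_x (normalized_deriv_seq m P (n + 1))) -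
    coord (normalized_deriv_seq (Suc m) P) j (normalized_deriv_seq m P (n + 1))"
  by (simp only: coord_smult[symmetric] times_x_normalized_deriv coord_diff coord_pderiv[OF assms])

lemma coord_deriv_deriv:
  assumes "monic_poly_seq P"
  shows "of_nat (n + 1) *
      coord (normalized_deriv_seq (Suc (Suc m)) P) j (normalized_deriv_seq (Suc m) P n) =
    of_nat (j + 1) *
      coord (normalized_deriv_seq (Suc m) P) (j + 1) (normalized_deriv_seq m P (n + 1))"
proof -
  have "(of_nat (n + 1) :: complex) \<noteq> 0" by (metis Suc_eq_plus1 of_nat_neq_0)
  then have "smult (of_nat (n + 1)) (normalized_deriv_seq (Suc m) P n) =
      pderiv (normalized_deriv_seq m P (n + 1))" by simp
  then show ?thesis
    by (simp only: coord_smult[symmetric] coord_pderiv[OF assms])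
qed

section \<open>Nonvanishing of the outermost diagonals\<close>

text \<open>Dividing by these binomials absorbs the factors \<open>n + 1\<close> and
  \<open>j + 1\<close> of the coordinate recursions along \<open>n = j + d\<close>.\<close>

lemma binomial_band_shift:
  "(of_nat (j + d + 1) :: complex) * of_nat ((j + d) choose d) = of_nat (j + 1) * of_nat ((j + d + 1) choose d)"
proof -
  have "(j + d + 1) * ((j + d) choose d) = (j + 1) * ((j + d + 1) choose d)"
    using Suc_times_binomial_eq[of "j + d" j] binomial_symmetric[of d "j + d"]
      binomial_symmetric[of d "Suc (j + d)"] by (simp add: ac_simps)
  then show ?thesis by (metis of_nat_mult)
qed

text \<open>If \<open>a (k + 1)\<close> is \<open>m + 2\<close> times \<open>g k\<close>, then
  \<open>g k\<close> is nonzero and cancels in \<open>rec\<close>, leaving the same relation at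
  \<open>k + d\<close> with multiple \<open>m + 1\<close>. Descent ends at multiple 1, excluded by
  \<open>b\<close>.\<close>

lemma riccati_nonvanishing:
  fixes a g :: "nat \<Rightarrow> complex"
  assumes a: "\<And>k. a k \<noteq> 0" and b: "\<And>k. a (k + 1) \<noteq> g k"
    and rec: "\<And>k. a (k + d + 1) * g k = g (k + d) * (a (k + 1) - g k)"
  shows "a (k + m) - of_nat m * g (k + m - 1) \<noteq> 0"
proof -
  have "a (k + 1) \<noteq> of_nat (Suc m) * g k" for m k
  proof (induction m arbitrary: k)
    case 0
    show ?case using b by simp
  next
    case (Suc m)
    show ?case
    proof
      assume eq: "a (k + 1) = of_nat (Suc (Suc m)) * g k"
      then have "g k \<noteq> 0" using a by (metis mult_zero_right)
      moreover have "a (k + d + 1) * g k = g (k + d) * (of_nat (Suc m) * g k)"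
        using rec[of k] eq by (simp add: algebra_simps)
      ultimately have "a (k + d + 1) = of_nat (Suc m) * g (k + d)" by simp
      then show False using Suc.IH[of "k + d"] by simp
    qed
  qed
  \<comment> \<open>For \<open>m = 0\<close> the truncated index is harmless, as its term has factor
    0, and the claim is \<open>a k \<noteq> 0\<close>.\<close>
  from this[of "k + m - 1" "m - 1"] show ?thesis using a by (cases m) auto
qed

lemma hahn_classical_exact_band:
  assumes P: "monic_poly_seq P" and band0: "exact_band d P"
    and band1: "exact_band d (normalized_deriv_seq 1 P)"
  shows "exact_band d (normalized_deriv_seq m P)"
proof -
  \<comment> \<open>\<open>a m\<close> is the matrix of multiplication by \<open>x\<close> at order
    \<open>m\<close>, and \<open>c m\<close> the connection matrix from order \<open>m\<close> to
    order \<open>m + 1\<close>. The second argument is the index of the expanded polynomial.\<close>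
  define a where "a m n j =
    coord (normalized_deriv_seq m P) j (times_x (normalized_deriv_seq m P n))" for m n j
  define c where "c m n j =
    coord (normalized_deriv_seq (Suc m) P) j (normalized_deriv_seq m P n)" for m n j
  have nz: "(of_nat (n + 1) :: complex) \<noteq> 0" for n by (metis Suc_eq_plus1 of_nat_neq_0)
  have a_rec: "of_nat (n + 1) * a (Suc m) n j = of_nat (j + 1) * a m (n + 1) (j + 1) - c m (n + 1) j"
    for m n j unfolding a_def c_def by (rule coord_times_x_deriv[OF P])
  have c_rec: "of_nat (n + 1) * c (Suc m) n j = of_nat (j + 1) * c m (n + 1) (j + 1)" for m n j
    unfolding c_def by (rule coord_deriv_deriv[OF P])
  have a0: "a 0 n j = 0" and a1: "a 1 n j = 0" if "j + d < n" for n j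
    using band0 band1 that by (auto simp: a_def exact_band_def)
  \<comment> \<open>At order 0, \<open>a_rec\<close> expresses \<open>c\<close> through entries of
    \<open>a 0\<close> and \<open>a 1\<close> that lie outside their bands.\<close>
  have c_band: "c m n j = 0" if "j + d + 1 < n" for m n j
    using that
  proof (induction m arbitrary: n j)
    case 0
    then obtain n' where n: "n = n' + 1" by (cases n) auto
    show ?case using a_rec[of n' 0 j] a0[of "j + 1" n] a1[of j n'] 0 by (simp add: n)
  next
    case (Suc m)
    then have "of_nat (n + 1) * c (Suc m) n j = 0" unfolding c_rec by simp
    then show ?case using nz[of n] by (simp del: of_nat_Suc of_nat_add)
  qed
  have a_band: "a m n j = 0" if "j + d < n" for m n j
    using that
  proof (induction m arbitrary: n j)
    case 0
    then show ?case by (rule a0)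
  next
    case (Suc m)
    then have "of_nat (n + 1) * a (Suc m) n j = 0"
      unfolding a_rec by (simp add: c_band)
    then show ?case using nz[of n] by (simp del: of_nat_Suc of_nat_add)
  qed
  define B :: "nat \<Rightarrow> complex" where "B j = of_nat ((j + d) choose d)" for j
  have B_nz: "B j \<noteq> 0" for j by (simp add: B_def)
  have B_shift: "of_nat (j + d + 1) * B j = of_nat (j + 1) * B (j + 1)" for j
    using binomial_band_shift[of j d] by (simp add: B_def)
  \<comment> \<open>With the binomial factor divided out, passing from \<open>m\<close> to \<open>m + 1\<close> merely shifts \<open>G\<close>.\<close>
  define A where "A m j = a m (j + d) j / B j" for m j
  define G where "G m j = c m (j + d + 1) j / (of_nat (j + d + 1) * B j)" for m j
  have aA: "a m (j + d) j = B j * A m j" for m j using B_nz by (simp add: A_def)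
  have cG: "c m (j + d + 1) j = of_nat (j + d + 1) * B j * G m j" for m j
    using B_nz nz[of "j + d"] by (simp add: G_def del: of_nat_add of_nat_Suc)
  have G_rec: "G (Suc m) j = G m (j + 1)" for m j
  proof -
    have "of_nat (j + d + 2) * (of_nat (j + d + 1) * B j * G (Suc m) j) =
        of_nat (j + d + 2) * (of_nat (j + 1) * B (j + 1) * G m (j + 1))"
      using c_rec[of "j + d + 1" m j] cG[of "Suc m" j] cG[of m "j + 1"]
      by (simp add: ac_simps)
    then have "(of_nat (j + d + 1) * B j) * G (Suc m) j = (of_nat (j + d + 1) * B j) * G m (j + 1)"
      using nz[of "j + d + 1"] by (simp only: B_shift) (simp del: of_nat_add of_nat_Suc)
    then show ?thesis using B_nz nz[of "j + d"] by (simp del: of_nat_add of_nat_Suc)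
  qed
  have A_rec: "A (Suc m) j = A m (j + 1) - G m j" for m j
  proof -
    have "of_nat (j + d + 1) * (B j * A (Suc m) j) =
        of_nat (j + 1) * (B (j + 1) * A m (j + 1)) - of_nat (j + d + 1) * B j * G m j"
      using a_rec[of "j + d" m j] aA[of "Suc m" j] aA[of m "j + 1"] cG[of m j]
      by (simp add: ac_simps)
    also have "\<dots> = of_nat (j + d + 1) * B j * (A m (j + 1) - G m j)"
      by (simp only: mult.assoc[symmetric] B_shift right_diff_distrib)
    finally show ?thesis using B_nz nz[of "j + d"] by (simp add: mult.assoc del: of_nat_add of_nat_Suc)
  qed
  have G_eq: "G m j = G 0 (j + m)" for m j
    by (induction m arbitrary: j) (auto simp: G_rec)
  \<comment> \<open>Every step subtracts \<open>G 0\<close> at the same index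
    \<open>j + m - 1\<close>, so the terms add up to a multiple.\<close>
  have A_eq: "A m j = A 0 (j + m) - of_nat m * G 0 (j + m - 1)" for m j
  proof (induction m arbitrary: j)
    case (Suc m)
    show ?case unfolding A_rec[of m j] Suc.IH[of "j + 1"] G_eq[of m j] by (simp add: algebra_simps)
  qed simp
  \<comment> \<open>Compare the outermost coefficient of \<open>x P\<^sub>n\<close> in the basis of normalized derivatives,
    expanding either \<open>x P\<^sub>n\<close> in the \<open>P\<^sub>i\<close> or \<open>P\<^sub>n\<close> in the derivatives first.\<close>
  have rec: "A 0 (j + d + 1) * G 0 j = G 0 (j + d) * (A 0 (j + 1) - G 0 j)" for j
  proof -
    let ?Q = "normalized_deriv_seq 1 P"
    have Q: "monic_poly_seq ?Q" by (rule monic_normalized_deriv_seq[OF P])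
    have c0: "coord ?Q i (P n) = c 0 n i" for n i by (simp add: c_def)
    \<comment> \<open>The bands reach down by \<open>d\<close> and \<open>d + 1\<close>, so this is
      the largest \<open>n\<close> for which coordinate \<open>j\<close> can survive. Each expansion
      then keeps a single intermediate index: \<open>j + d + 1\<close> or
      \<open>j + d\<close>.\<close>
    define n where "n = j + 2 * d + 1"
    have n: "n = j + d + 1 + d" "n = j + d + d + 1" by (simp_all add: n_def)
    have "times_x (P n) = (\<Sum>i\<le>n + 1. smult (a 0 n i) (P i))"
      using coord_expansion[OF P, of "times_x (P n)" "n + 1"] degree_times_x[of "P n"]
      by (simp add: degree_monic_seq[OF P] a_def)
    then have "coord ?Q j (times_x (P n)) = (\<Sum>i\<le>n + 1. a 0 n i * c 0 i j)"
      by (simp only: coord_sum coord_smult c0)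
    also have "\<dots> = (\<Sum>i\<in>{j + d + 1}. a 0 n i * c 0 i j)"
    proof (rule sum.mono_neutral_right; (intro ballI)?)
      fix i assume "i \<in> {..n + 1} - {j + d + 1}"
      then have "i + d < n \<or> j + d + 1 < i" by (auto simp: n_def)
      then show "a 0 n i * c 0 i j = 0" using a_band c_band by auto
    qed (auto simp: n_def)
    finally have 1: "coord ?Q j (times_x (P n)) = a 0 n (j + d + 1) * c 0 (j + d + 1) j"
      by simp
    have "P n = (\<Sum>i\<le>n. smult (c 0 n i) (?Q i))"
      using coord_expansion[OF Q, of "P n" n] by (simp add: degree_monic_seq[OF P] c_def)
    then have "times_x (P n) = (\<Sum>i\<le>n. smult (c 0 n i) (times_x (?Q i)))"
      by (metis (no_types, lifting) sum_distrib_left mult_smult_right sum.cong)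
    then have "coord ?Q j (times_x (P n)) = (\<Sum>i\<le>n. c 0 n i * a 1 i j)"
      by (simp only: coord_sum coord_smult a_def)
    also have "\<dots> = (\<Sum>i\<in>{j + d}. c 0 n i * a 1 i j)"
    proof (rule sum.mono_neutral_right; (intro ballI)?)
      fix i assume "i \<in> {..n} - {j + d}"
      then have "i + d + 1 < n \<or> j + d < i" by (auto simp: n_def)
      then show "c 0 n i * a 1 i j = 0" using a_band c_band by auto
    qed (auto simp: n_def)
    finally have 2: "coord ?Q j (times_x (P n)) = c 0 n (j + d) * a 1 (j + d) j"
      by simp
    have "B (j + d + 1) * A 0 (j + d + 1) * (of_nat (j + d + 1) * B j * G 0 j) =
        of_nat (j + d + d + 1) * B (j + d) * G 0 (j + d) * (B j * A 1 j)"
      using 1 2 by (metis n aA cG)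
    also have "of_nat (j + d + d + 1) * B (j + d) = of_nat (j + d + 1) * B (j + d + 1)"
      by (rule B_shift)
    finally have "(of_nat (j + d + 1) * B (j + d + 1) * B j) * (A 0 (j + d + 1) * G 0 j) =
        (of_nat (j + d + 1) * B (j + d + 1) * B j) * (G 0 (j + d) * A 1 j)"
      by (simp only: ac_simps)
    then have "A 0 (j + d + 1) * G 0 j = G 0 (j + d) * A 1 j"
      using B_nz nz[of "j + d"] by (simp del: of_nat_add of_nat_Suc)
    then show ?thesis using A_rec[of 0 j] by simp
  qed
  have A0: "A 0 j \<noteq> 0" for j
    using band0 B_nz by (simp add: A_def a_def exact_band_def)
  have "A 1 j \<noteq> 0" for j
    using band1 B_nz unfolding A_def a_def exact_band_def by simp
  \<comment> \<open>By \<open>A_rec\<close>, nonvanishing at order 1 is exactly hypothesis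
    \<open>b\<close> of the descent.\<close>
  then have A1: "A 0 (j + 1) \<noteq> G 0 j" for j
    using A_rec[of 0 j] by (metis One_nat_def right_minus_eq)
  have "A m j \<noteq> 0" for j
    using riccati_nonvanishing[OF A0 A1 rec] by (subst A_eq)
  then have "a m (j + d) j \<noteq> 0" for j using B_nz by (simp add: aA)
  then show ?thesis using a_band[of _ _ m] by (simp add: exact_band_def a_def)
qed

theorem mainTheorem3:
  fixes d :: nat and P :: "nat \<Rightarrow> complex poly"
  assumes "d \<ge> 1"
    and "hahn_classical d P"
  shows "very_classical d P"
proof -
  have P: "d_OPS d P" "d_OPS d (normalized_deriv_seq 1 P)"
    using assms(2) by (auto simp: hahn_classical_def)
  then have monic: "monic_poly_seq P" by (simp add: d_OPS_def)
  have "d_OPS d (normalized_deriv_seq m P)" for m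
    using exact_band_imp_d_OPS[OF monic_normalized_deriv_seq[OF monic]]
      hahn_classical_exact_band[OF monic P[THEN d_OPS_imp_exact_band[OF assms(1)]]] .
  then show ?thesis using P by (simp add: very_classical_def)
qed

end
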